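(* Let $X$ be an arbitrary finite metric space consisting of $n\ge1$ points, and let $k$ be the least positive integer such that $n\le k(k-1)/2$. Then $X$ can be isometrically embedded into $\mathcal{M}$ in such a way that its image belongs to $\mathcal{M}_{[k]}$; that is, there exists a mapping $\varphi\colon X\to\mathcal{M}$ with $\varphi(X)\subset\mathcal{M}_{[k]}$ and $d_{GH}(\varphi(x),\varphi(y))=|xy|$ for all $x,y\in X$.
   Context: $|xy|$ denotes the distance between points $x,y$ of a metric space. $\mathcal{M}$ is the set of isometry classes of (nonempty) compact metric spaces, endowed with the Gromov--Hausdorff metric $d_{GH}$. $\mathcal{M}_{[k]}\subset\mathcal{M}$ is the subset consisting of all metric spaces having exactly $k$ points. An isometric embedding is a distance-preserving map. *)

theory Defs
  imports "HOL-Analysis.Analysis"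
begin

definition isometric :: "'a metric \<Rightarrow> 'b metric \<Rightarrow> bool" where
  "isometric X Y \<longleftrightarrow>
     (\<exists>f. bij_betw f (mspace X) (mspace Y) \<and>
          (\<forall>x\<in>mspace X. \<forall>y\<in>mspace X. mdist Y (f x) (f y) = mdist X x y))"

definition nbhd :: "'a metric \<Rightarrow> real \<Rightarrow> 'a set \<Rightarrow> 'a set" where
  "nbhd Z r A = (\<Union>a\<in>A. mball_of Z a r)"

text \<open>The infimum is only meaningful for nonempty bounded \<open>A\<close> and \<open>B\<close>, which is the case for isometric copies of nonempty compact spaces.\<close>

definition hausdorff_dist :: "'a metric \<Rightarrow> 'a set \<Rightarrow> 'a set \<Rightarrow> real" where
  "hausdorff_dist Z A B = Inf {r. r > 0 \<and> A \<subseteq> nbhd Z r B \<and> B \<subseteq> nbhd Z r A}"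

text \<open>
  Gromov--Hausdorff distance: the infimum of the Hausdorff distances between isometric
  copies \<open>A\<close> of \<open>X\<close> and \<open>B\<close> of \<open>Y\<close> in a common ambient metric space \<open>Z\<close>.
  Since \<open>Z\<close> may be replaced by its subspace \<open>A \<union> B\<close>, which has a copy on the type
  \<open>'a + 'b\<close>, it suffices to let \<open>Z\<close> range over the metric spaces carried by that type;
  see \<open>gh_dist_le\<close> below.
\<close>

definition gh_dist :: "'a metric \<Rightarrow> 'b metric \<Rightarrow> real" where
  "gh_dist X Y =
     Inf {hausdorff_dist Z A B | (Z :: ('a + 'b) metric) A B.
            A \<subseteq> mspace Z \<and> B \<subseteq> mspace Z \<and>
            isometric X (submetric Z A) \<and> isometric Y (submetric Z B)}"

lemma isometric_refl: "isometric X X"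
  unfolding isometric_def by (rule exI[of _ id]) auto

lemma isometric_sym:
  assumes "isometric X Y" shows "isometric Y X"
proof -
  obtain f where f: "bij_betw f (mspace X) (mspace Y)"
    "\<forall>x\<in>mspace X. \<forall>y\<in>mspace X. mdist Y (f x) (f y) = mdist X x y"
    using assms by (auto simp: isometric_def)
  let ?g = "inv_into (mspace X) f"
  have "mdist X (?g x) (?g y) = mdist Y x y" if "x \<in> mspace Y" "y \<in> mspace Y" for x y
  proof -
    have "?g x \<in> mspace X" "?g y \<in> mspace X"
      using bij_betwE[OF bij_betw_inv_into[OF f(1)]] that by auto
    then have "mdist Y (f (?g x)) (f (?g y)) = mdist X (?g x) (?g y)"
      using f(2) by blast
    then show ?thesis
      using bij_betw_inv_into_right[OF f(1)] that by simp
  qed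
  then show ?thesis
    unfolding isometric_def using bij_betw_inv_into[OF f(1)] by blast
qed

lemma isometric_trans:
  assumes "isometric X Y" "isometric Y Z" shows "isometric X Z"
proof -
  obtain f where f: "bij_betw f (mspace X) (mspace Y)"
    "\<forall>x\<in>mspace X. \<forall>y\<in>mspace X. mdist Y (f x) (f y) = mdist X x y"
    using assms by (auto simp: isometric_def)
  obtain g where g: "bij_betw g (mspace Y) (mspace Z)"
    "\<forall>x\<in>mspace Y. \<forall>y\<in>mspace Y. mdist Z (g x) (g y) = mdist Y x y"
    using assms by (auto simp: isometric_def)
  have "f x \<in> mspace Y" if "x \<in> mspace X" for x
    using f(1) that bij_betwE by blast
  then show ?thesis
    unfolding isometric_def using f g bij_betw_trans[OF f(1) g(1)]
    by (intro exI[of _ "g \<circ> f"]) auto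
qed

lemma isometric_iff_cong:
  "isometric X Y \<Longrightarrow> isometric X Z \<longleftrightarrow> isometric Y Z"
  by (meson isometric_sym isometric_trans)

lemma gh_dist_cong:
  fixes X X' :: "'a metric" and Y Y' :: "'b metric"
  assumes "isometric X X'" "isometric Y Y'"
  shows "gh_dist X Y = gh_dist X' Y'"
  unfolding gh_dist_def isometric_iff_cong[OF assms(1)] isometric_iff_cong[OF assms(2)] ..

lemma isometric_submetric_image:
  assumes "inj_on h C" "C \<subseteq> mspace Z" "h ` C \<subseteq> mspace W"
    and "\<And>x y. x \<in> C \<Longrightarrow> y \<in> C \<Longrightarrow> mdist W (h x) (h y) = mdist Z x y"
  shows "isometric (submetric Z C) (submetric W (h ` C))"
  unfolding isometric_def using assms
  by (intro exI[of _ h]) (auto simp: bij_betw_def Int_absorb2)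

text \<open>The choice of the type \<open>'a + 'b\<close> for the ambient spaces is harmless.\<close>

lemma gh_dist_le:
  fixes X :: "'a metric" and Y :: "'b metric" and Z :: "'c metric"
  assumes AZ: "A \<subseteq> mspace Z" and BZ: "B \<subseteq> mspace Z"
    and XA: "isometric X (submetric Z A)" and YB: "isometric Y (submetric Z B)"
  shows "gh_dist X Y \<le> hausdorff_dist Z A B"
proof -
  obtain f where f: "bij_betw f (mspace X) A"
    using XA AZ by (auto simp: isometric_def Int_absorb2)
  obtain g where g: "bij_betw g (mspace Y) B"
    using YB BZ by (auto simp: isometric_def Int_absorb2)
  define h :: "'c \<Rightarrow> 'a + 'b" where
    "h z = (if z \<in> A then Inl (inv_into (mspace X) f z) else Inr (inv_into (mspace Y) g z))" for z
  define C where "C = A \<union> B"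
  have CZ: "C \<subseteq> mspace Z" using AZ BZ by (auto simp: C_def)
  have inj: "inj_on h C"
    using bij_betw_inv_into[OF f] bij_betw_inv_into[OF g]
    by (auto simp: inj_on_def h_def C_def bij_betw_def)
  define k where "k = inv_into C h"
  have k[simp]: "k (h z) = z" if "z \<in> C" for z
    using inj that by (simp add: k_def)
  define d where "d u v = (mdist Z (k u) (k v))" for u v
  interpret W: Metric_space "h ` C" d
    using CZ by unfold_locales
      (auto simp: d_def mdist_commute subset_iff mdist_triangle)
  define W where "W = metric (h ` C, d)"
  have [simp]: "mspace W = h ` C" "mdist W = d" by (simp_all add: W_def)
  have iso: "mdist W (h x) (h y) = mdist Z x y" if "x \<in> C" "y \<in> C" for x y
    using that by (simp add: d_def)
  have sub: "isometric (submetric Z D) (submetric W (h ` D))" if "D \<subseteq> C" for D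
  proof (rule isometric_submetric_image)
    show "inj_on h D" using inj that by (rule inj_on_subset)
    show "D \<subseteq> mspace Z" "h ` D \<subseteq> mspace W" using that CZ by auto
    show "mdist W (h x) (h y) = mdist Z x y" if "x \<in> D" "y \<in> D" for x y
      using that \<open>D \<subseteq> C\<close> by (intro iso) auto
  qed
  have nb: "h ` D \<subseteq> nbhd W r (h ` E) \<longleftrightarrow> D \<subseteq> nbhd Z r E" if "D \<subseteq> C" "E \<subseteq> C" for D E r
  proof -
    have "h x \<in> nbhd W r (h ` E) \<longleftrightarrow> x \<in> nbhd Z r E" if "x \<in> D" for x
    proof -
      have "x \<in> C" using that \<open>D \<subseteq> C\<close> by blast
      have "h x \<in> mball_of W (h e) r \<longleftrightarrow> x \<in> mball_of Z e r" if "e \<in> E" for e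
      proof -
        have "e \<in> C" using that \<open>E \<subseteq> C\<close> by blast
        then show ?thesis
          using \<open>x \<in> C\<close> CZ by (simp add: d_def subset_iff)
      qed
      then show ?thesis
        unfolding nbhd_def UN_iff by simp
    qed
    then show ?thesis by blast
  qed
  have eq: "hausdorff_dist W (h ` A) (h ` B) = hausdorff_dist Z A B"
    unfolding hausdorff_dist_def by (simp add: nb C_def)
  have bdd: "bdd_below {hausdorff_dist Z A B | (Z :: ('a + 'b) metric) A B.
            A \<subseteq> mspace Z \<and> B \<subseteq> mspace Z \<and>
            isometric X (submetric Z A) \<and> isometric Y (submetric Z B)}" (is "bdd_below ?S")
  proof -
    have low: "hausdorff_dist Z A B \<ge> min 0 (Inf {})" for Z :: "('a + 'b) metric" and A B
    proof (cases "{r. r > 0 \<and> A \<subseteq> nbhd Z r B \<and> B \<subseteq> nbhd Z r A} = {}")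
      case True
      then show ?thesis unfolding hausdorff_dist_def True by simp
    next
      case False
      then have "hausdorff_dist Z A B \<ge> 0"
        unfolding hausdorff_dist_def by (intro cInf_greatest) auto
      then show ?thesis by simp
    qed
    then show ?thesis unfolding bdd_below_def by blast
  qed
  have "hausdorff_dist W (h ` A) (h ` B) \<in> ?S"
  proof -
    have "isometric X (submetric W (h ` A))" "isometric Y (submetric W (h ` B))"
      using sub[of A] sub[of B] XA YB isometric_trans by (auto simp: C_def)
    then show ?thesis
      by (intro CollectI exI[of _ W] exI[of _ "h ` A"] exI[of _ "h ` B"]) (auto simp: C_def)
  qed
  then have "gh_dist X Y \<le> hausdorff_dist W (h ` A) (h ` B)"
    unfolding gh_dist_def using bdd by (rule cInf_lower)
  then show ?thesis by (simp add: eq)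
qed

text \<open>
  The set of isometry classes of nonempty compact metric spaces.  A compact metric space has
  at most continuum many points, so representatives carried by subsets of \<open>real\<close> suffice.
  Only the type of the carrier is used here: the metric on it is arbitrary.
\<close>

lemma compact_metric_on_real:
  fixes X :: "'a metric"
  assumes "compact_space (mtopology_of X)"
  shows "\<exists>Y :: real metric. isometric X Y"
proof -
  interpret Metric_space "mspace X" "mdist X" by auto
  have comp: "compact_space mtopology"
    using assms by (simp add: mtopology_of_def)
  then have tb: "mtotally_bounded (mspace X)"
    using compactin_imp_mtotally_bounded by (auto simp: compact_space_def)
  have "\<exists>K. finite K \<and> K \<subseteq> mspace X \<and> mspace X \<subseteq> (\<Union>c\<in>K. mball c (1 / real (Suc n)))" for n
    using tb unfolding mtotally_bounded_def by simp
  then obtain K where K: "\<And>n. finite (K n)"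
    "\<And>n. mspace X \<subseteq> (\<Union>c\<in>K n. mball c (1 / real (Suc n)))"
    by metis
  define S where "S = (SIGMA n:UNIV. K n)"
  have S: "countable S"
    unfolding S_def using K(1) by (intro countable_SIGMA) (auto intro: countable_finite)
  define f where "f x = to_nat_on S ` {p \<in> S. x \<in> mball (snd p) (1 / real (Suc (fst p)))}" for x
  have "inj_on f (mspace X)"
  proof (rule inj_onI, rule ccontr)
    fix x y assume xy: "x \<in> mspace X" "y \<in> mspace X" "f x = f y" "x \<noteq> y"
    then have "0 < mdist X x y / 2" by simp
    then obtain n where n: "1 / real (Suc n) < mdist X x y / 2"
      using nat_approx_posE by blast
    obtain c where c: "c \<in> K n" "x \<in> mball c (1 / real (Suc n))"
      using K(2)[of n] xy by blast
    have "{p \<in> S. x \<in> mball (snd p) (1 / real (Suc (fst p)))} =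
          {p \<in> S. y \<in> mball (snd p) (1 / real (Suc (fst p)))}"
      using xy(3) unfolding f_def
      by (rule inj_on_image_eq_iff[OF inj_on_to_nat_on[OF S], THEN iffD1, rotated 2]) auto
    moreover have "(n, c) \<in> {p \<in> S. x \<in> mball (snd p) (1 / real (Suc (fst p)))}"
      using c by (simp add: S_def)
    ultimately have "y \<in> mball c (1 / real (Suc n))"
      by (metis (mono_tags, lifting) fst_conv mem_Collect_eq snd_conv)
    then have "mdist X c x < 1 / real (Suc n)" "mdist X c y < 1 / real (Suc n)" "c \<in> mspace X"
      using c by auto
    then have "mdist X x y < 2 * (1 / real (Suc n))"
      using triangle[of x c y] commute[of x c] xy by linarith
    then show False using n by linarith
  qed
  moreover obtain g :: "nat set \<Rightarrow> real" where "inj g"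
    using nat_sets_eqpoll_reals unfolding eqpoll_def bij_betw_def by blast
  ultimately have inj: "inj_on (g \<circ> f) (mspace X)"
    by (meson comp_inj_on inj_on_subset subset_UNIV)
  define h where "h = g \<circ> f"
  define k where "k = inv_into (mspace X) h"
  have k[simp]: "k (h z) = z" if "z \<in> mspace X" for z
    using inj that unfolding k_def h_def by (rule inv_into_f_f)
  define d where "d u v = (mdist X (k u) (k v))" for u v
  interpret W: Metric_space "h ` mspace X" d
    by unfold_locales (auto simp: d_def mdist_commute mdist_triangle)
  have "isometric X (metric (h ` mspace X, d))"
    unfolding isometric_def using inj
    by (intro exI[of _ h]) (auto simp: d_def bij_betw_def h_def[symmetric])
  then show ?thesis by blast
qed

definition compact_isometric :: "real metric \<Rightarrow> real metric \<Rightarrow> bool" where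
  "compact_isometric X Y \<longleftrightarrow>
     mspace X \<noteq> {} \<and> compact_space (mtopology_of X) \<and>
     mspace Y \<noteq> {} \<and> compact_space (mtopology_of Y) \<and> isometric X Y"

lemma part_equivp_compact_isometric: "part_equivp compact_isometric"
proof (rule part_equivpI)
  have "Metric_space {0::real} dist" by unfold_locales (auto simp: dist_triangle dist_commute)
  then have "mspace (metric ({0::real}, dist)) = {0}"
    by (simp add: Metric_space.mspace_metric)
  then have "compact_isometric (metric ({0::real}, dist)) (metric ({0}, dist))"
    unfolding compact_isometric_def
    by (simp add: isometric_refl compact_space_def finite_imp_compactin)
  then show "\<exists>X. compact_isometric X X" by blast
  show "symp compact_isometric"
    by (auto intro!: sympI intro: isometric_sym simp: compact_isometric_def)
  show "transp compact_isometric"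
    by (auto intro!: transpI intro: isometric_trans simp: compact_isometric_def)
qed

quotient_type gh_space = "real metric" / partial: compact_isometric
  by (rule part_equivp_compact_isometric)

lift_definition d_GH :: "gh_space \<Rightarrow> gh_space \<Rightarrow> real" is gh_dist
  by (auto simp: compact_isometric_def intro: gh_dist_cong)

lift_definition has_points :: "gh_space \<Rightarrow> nat \<Rightarrow> bool"
  is "\<lambda>X k. finite (mspace X) \<and> card (mspace X) = k"
  unfolding compact_isometric_def isometric_def
  by (metis bij_betw_finite bij_betw_same_card)

definition gh_points :: "nat \<Rightarrow> gh_space set" where
  "gh_points k = {P. has_points P k}"

end

theory Submission
  imports Defs
begin

text \<open>
  Attach to each point \<open>x\<close> of \<open>X\<close> a metric on a fixed \<open>k\<close>-point set, whose edges \<open>{i, j}\<close> have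
  length \<open>C {i, j} + 2 |x p{i, j}|\<close>.  Here \<open>p\<close> maps the edges onto \<open>X\<close>, which is possible since
  there are at least \<open>n\<close> of them, and the \<open>C\<close> are large constants with pairwise differences
  of at least four times the diameter of \<open>X\<close>.  A map of small distortion between two such
  spaces is then injective and fixes every edge, so its distortion is twice the sup-distance
  between the Kuratowski images \<open>|x \<cdot>|\<close> and \<open>|y \<cdot>|\<close> of the two points, that is, \<open>2 |xy|\<close>.
\<close>

section \<open>Distortion and the Gromov--Hausdorff distance\<close>

text \<open>Neighbourhoods are built from open balls, so the radius \<open>r\<close> itself may
  fail; the bound arises as a limit from larger radii.\<close>

lemma hausdorff_dist_le:
  assumes "r \<ge> 0" and "\<And>s. s > r \<Longrightarrow> A \<subseteq> nbhd Z s B \<and> B \<subseteq> nbhd Z s A"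
  shows "hausdorff_dist Z A B \<le> r"
proof (rule dense_ge)
  fix s assume "r < s"
  then show "hausdorff_dist Z A B \<le> s"
    unfolding hausdorff_dist_def using assms
    by (intro cInf_lower) (auto intro: bdd_belowI[of _ 0])
qed

text \<open>The sum of all distances dominates each single one, which gives a crude admissible
  radius for finite sets.\<close>

lemma subset_nbhd_sum:
  assumes "finite A" "finite B" "B \<noteq> {}" "A \<subseteq> mspace Z" "B \<subseteq> mspace Z"
    and "(\<Sum>b\<in>B. \<Sum>a\<in>A. mdist Z b a) < r"
  shows "A \<subseteq> nbhd Z r B"
proof
  fix a assume a: "a \<in> A"
  obtain b where b: "b \<in> B" using assms(3) by blast
  have "mdist Z b a \<le> (\<Sum>a\<in>A. mdist Z b a)"
    using a assms(1) by (intro member_le_sum) auto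
  also have "\<dots> \<le> (\<Sum>b\<in>B. \<Sum>a\<in>A. mdist Z b a)"
    using b assms(2) by (intro member_le_sum[of b B "\<lambda>b. \<Sum>a\<in>A. mdist Z b a"]) (auto intro: sum_nonneg)
  finally have "mdist Z b a < r" using assms(6) by simp
  then show "a \<in> nbhd Z r B"
    unfolding nbhd_def using a b assms(4,5) by auto
qed

lemma hausdorff_dist_lessD:
  assumes "finite A" "finite B" "A \<noteq> {}" "B \<noteq> {}" "A \<subseteq> mspace Z" "B \<subseteq> mspace Z"
    and "hausdorff_dist Z A B < r"
  obtains s where "0 < s" "s < r" "A \<subseteq> nbhd Z s B" "B \<subseteq> nbhd Z s A"
proof -
  let ?S = "{r. r > 0 \<and> A \<subseteq> nbhd Z r B \<and> B \<subseteq> nbhd Z r A}"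
  \<comment> \<open>An infimum below \<open>r\<close> yields a radius below \<open>r\<close> only if
    some radius is admissible. \<open>u\<close> is one; the added 1 makes it positive and the bounds
    strict.\<close>
  define u where "u = (\<Sum>b\<in>B. \<Sum>a\<in>A. mdist Z b a) + (\<Sum>a\<in>A. \<Sum>b\<in>B. mdist Z a b) + 1"
  have nn: "0 \<le> (\<Sum>b\<in>B. \<Sum>a\<in>A. mdist Z b a)" "0 \<le> (\<Sum>a\<in>A. \<Sum>b\<in>B. mdist Z a b)"
    by (intro sum_nonneg; simp)+
  have "A \<subseteq> nbhd Z u B"
    using assms nn by (intro subset_nbhd_sum) (simp_all add: u_def)
  moreover have "B \<subseteq> nbhd Z u A"
    using assms nn by (intro subset_nbhd_sum) (simp_all add: u_def)
  moreover have "u > 0" using nn by (simp add: u_def)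
  ultimately have "?S \<noteq> {}" by blast
  then obtain s where "s \<in> ?S" "s < r"
    using cInf_lessD[of ?S r] assms(7) unfolding hausdorff_dist_def by blast
  then show thesis using that by blast
qed

text \<open>The two spaces are glued by joining every related pair with a bridge of length
  \<open>r\<close>. A detour through the other space crosses two bridges, and their total length
  \<open>2 * r\<close> pays for the distortion of \<open>R\<close>.\<close>

lemma correspondence_ambient_space:
  fixes X :: "'a metric" and Y :: "'b metric"
  assumes fin: "finite R" and ne: "R \<noteq> {}" and r: "r > 0"
    and fst: "fst ` R = mspace X" and snd: "snd ` R = mspace Y"
    and dis: "\<And>x y x' y'. (x, y) \<in> R \<Longrightarrow> (x', y') \<in> R \<Longrightarrow> \<bar>mdist X x x' - mdist Y y y'\<bar> \<le> 2 * r"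
  obtains Z :: "('a + 'b) metric" and A B
  where "A \<subseteq> mspace Z" "B \<subseteq> mspace Z"
    "isometric X (submetric Z A)" "isometric Y (submetric Z B)" "hausdorff_dist Z A B \<le> r"
proof -
  \<comment> \<open>Length of a shortest path from \<open>x\<close> to \<open>y\<close> over a
    single bridge.\<close>
  define c where "c x y = Min ((\<lambda>(a, b). mdist X x a + r + mdist Y b y) ` R)" for x y
  have c_le: "c x y \<le> mdist X x a + r + mdist Y b y" if "(a, b) \<in> R" for x y a b
    unfolding c_def using fin that by (intro Min_le) (auto intro!: rev_image_eqI)
  have c_ex: "\<exists>a b. (a, b) \<in> R \<and> c x y = mdist X x a + r + mdist Y b y" for x y
  proof -
    have "c x y \<in> (\<lambda>(a, b). mdist X x a + r + mdist Y b y) ` R"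
      unfolding c_def using fin ne by (intro Min_in) auto
    then show ?thesis by auto
  qed
  have RX: "a \<in> mspace X" and RY: "b \<in> mspace Y" if "(a, b) \<in> R" for a b
    using that fst snd by force+
  have c_pos: "c x y > 0" for x y
    using c_ex[of x y] r by (metis add_nonneg_pos add_pos_nonneg mdist_nonneg)
  \<comment> \<open>The detour \<open>x\<close>, \<open>a\<close>, \<open>b\<close>,
    \<open>y\<close>, \<open>b'\<close>, \<open>a'\<close>, \<open>x'\<close> is no shortcut, since
    \<open>dis\<close> bounds the distance of \<open>a\<close> and \<open>a'\<close> by that of
    \<open>b\<close> and \<open>b'\<close> plus \<open>2 * r\<close>. \<open>tri2\<close> is the
    mirror image.\<close>
  have tri1: "mdist X x x' \<le> c x y + c x' y" if xs: "x \<in> mspace X" "x' \<in> mspace X" "y \<in> mspace Y" for x x' y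
  proof -
    obtain a b where ab: "(a, b) \<in> R" "c x y = mdist X x a + r + mdist Y b y"
      using c_ex by blast
    obtain a' b' where ab': "(a', b') \<in> R" "c x' y = mdist X x' a' + r + mdist Y b' y"
      using c_ex by blast
    have "mdist X x x' \<le> mdist X x a + mdist X a x'" "mdist X a x' \<le> mdist X a a' + mdist X a' x'"
      "mdist Y b b' \<le> mdist Y b y + mdist Y y b'"
      using xs RX RY ab ab' by (auto intro!: mdist_triangle)
    then show ?thesis
      using ab ab' dis[OF ab(1) ab'(1)]
      by (simp add: mdist_commute[of X a' x'] mdist_commute[of Y y b'])
  qed
  have tri2: "mdist Y y y' \<le> c x y + c x y'" if xs: "y \<in> mspace Y" "y' \<in> mspace Y" "x \<in> mspace X" for x y y'
  proof -
    obtain a b where ab: "(a, b) \<in> R" "c x y = mdist X x a + r + mdist Y b y"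
      using c_ex by blast
    obtain a' b' where ab': "(a', b') \<in> R" "c x y' = mdist X x a' + r + mdist Y b' y'"
      using c_ex by blast
    have "mdist Y y y' \<le> mdist Y y b + mdist Y b y'" "mdist Y b y' \<le> mdist Y b b' + mdist Y b' y'"
      "mdist X a a' \<le> mdist X a x + mdist X x a'"
      using xs RX RY ab ab' by (auto intro!: mdist_triangle)
    then show ?thesis
      using ab ab' dis[OF ab(1) ab'(1)]
      by (simp add: mdist_commute[of X a x] mdist_commute[of Y y b])
  qed
  \<comment> \<open>The bridge that is optimal for \<open>x'\<close> is also a candidate for
    \<open>x\<close>; \<open>tri4\<close> argues likewise in the other space.\<close>
  have tri3: "c x y \<le> mdist X x x' + c x' y" if xs: "x \<in> mspace X" "x' \<in> mspace X" for x x' y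
  proof -
    obtain a b where ab: "(a, b) \<in> R" "c x' y = mdist X x' a + r + mdist Y b y"
      using c_ex by blast
    then show ?thesis
      using c_le[OF ab(1), of x y] mdist_triangle[OF xs RX[OF ab(1)]] by simp
  qed
  have tri4: "c x y \<le> c x y' + mdist Y y' y" if xs: "y \<in> mspace Y" "y' \<in> mspace Y" for x y y'
  proof -
    obtain a b where ab: "(a, b) \<in> R" "c x y' = mdist X x a + r + mdist Y b y'"
      using c_ex by blast
    then show ?thesis
      using c_le[OF ab(1), of x y] mdist_triangle[OF RY[OF ab(1)] xs(2,1)] by simp
  qed
  define d where "d u v = (case u of
       Inl x \<Rightarrow> (case v of Inl x' \<Rightarrow> mdist X x x' | Inr y \<Rightarrow> c x y)
     | Inr y \<Rightarrow> (case v of Inl x \<Rightarrow> c x y | Inr y' \<Rightarrow> mdist Y y y'))" for u v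
  have [simp]: "d (Inl x) (Inl x') = mdist X x x'" "d (Inl x) (Inr y) = c x y"
    "d (Inr y) (Inl x) = c x y" "d (Inr y) (Inr y') = mdist Y y y'" for x x' y y'
    by (simp_all add: d_def)
  define A B where "A = (Inl ` mspace X :: ('a + 'b) set)" and "B = (Inr ` mspace Y :: ('a + 'b) set)"
  interpret Z: Metric_space "A \<union> B" d
  proof
    show "0 \<le> d u v" for u v
      by (cases u; cases v) (auto intro: less_imp_le c_pos)
    show "d u v = d v u" for u v
      by (cases u; cases v) (auto simp: mdist_commute)
    show "d u v = 0 \<longleftrightarrow> u = v" if "u \<in> A \<union> B" "v \<in> A \<union> B" for u v
      using that c_pos by (auto simp: A_def B_def less_imp_neq[symmetric])
    show "d u w \<le> d u v + d v w" if "u \<in> A \<union> B" "v \<in> A \<union> B" "w \<in> A \<union> B" for u v w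
      using that
      by (auto simp: A_def B_def mdist_triangle tri1 tri2 tri3 tri4)
         (metis add.commute mdist_commute tri3 tri4)+
  qed
  define Z where "Z = metric (A \<union> B, d)"
  have Z [simp]: "mspace Z = A \<union> B" "mdist Z = d" by (simp_all add: Z_def)
  have "isometric X (submetric Z A)"
    unfolding isometric_def by (intro exI[of _ Inl]) (auto simp: A_def bij_betw_def)
  moreover have "isometric Y (submetric Z B)"
    unfolding isometric_def by (intro exI[of _ Inr]) (auto simp: B_def bij_betw_def)
  moreover have "hausdorff_dist Z A B \<le> r"
  proof (rule hausdorff_dist_le)
    show "r \<ge> 0" using r by simp
    fix s assume "r < s"
    \<comment> \<open>The bridge at the pair itself shows that related points are at distance at
      most \<open>r\<close>.\<close>
    have less: "c a b < s" if "(a, b) \<in> R" for a b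
    proof -
      have "mdist X a a = 0" "mdist Y b b = 0" using RX[OF that] RY[OF that] by simp_all
      then show ?thesis using c_le[OF that, of a b] \<open>r < s\<close> by simp
    qed
    have "A \<subseteq> nbhd Z s B"
    proof
      fix u assume "u \<in> A"
      then obtain a b where "u = Inl a" "(a, b) \<in> R" using fst by (force simp: A_def)
      then show "u \<in> nbhd Z s B"
        using less RX RY unfolding nbhd_def by (intro UN_I[of "Inr b"]) (auto simp: A_def B_def)
    qed
    moreover have "B \<subseteq> nbhd Z s A"
    proof
      fix u assume "u \<in> B"
      then obtain a b where "u = Inr b" "(a, b) \<in> R" using snd by (force simp: B_def)
      then show "u \<in> nbhd Z s A"
        using less RX RY unfolding nbhd_def by (intro UN_I[of "Inl a"]) (auto simp: A_def B_def)
    qed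
    ultimately show "A \<subseteq> nbhd Z s B \<and> B \<subseteq> nbhd Z s A" ..
  qed
  ultimately show thesis using that[of A Z B] by simp
qed

lemma gh_dist_le_distortion:
  fixes X :: "'a metric" and Y :: "'b metric"
  assumes "finite R" "R \<noteq> {}" "r > 0" "fst ` R = mspace X" "snd ` R = mspace Y"
    and "\<And>x y x' y'. (x, y) \<in> R \<Longrightarrow> (x', y') \<in> R \<Longrightarrow> \<bar>mdist X x x' - mdist Y y y'\<bar> \<le> 2 * r"
  shows "gh_dist X Y \<le> r"
proof -
  obtain Z :: "('a + 'b) metric" and A B where
    "A \<subseteq> mspace Z" "B \<subseteq> mspace Z"
    "isometric X (submetric Z A)" "isometric Y (submetric Z B)" "hausdorff_dist Z A B \<le> r"
    by (rule correspondence_ambient_space[OF assms])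
  then show ?thesis using gh_dist_le[of A Z B X Y] by linarith
qed

text \<open>If copies of the spaces lay at Hausdorff distance below \<open>r\<close>, sending each
  point of \<open>X\<close> to a point of \<open>Y\<close> closer than \<open>r\<close> would change
  all distances by less than \<open>2 * r\<close>. Hence it is enough to test maps, surjective or
  not.\<close>

lemma gh_dist_ge_distortion:
  fixes X :: "'a metric" and Y :: "'b metric"
  assumes fin: "finite (mspace X)" "finite (mspace Y)" and ne: "mspace X \<noteq> {}" "mspace Y \<noteq> {}"
    and dis: "\<And>\<sigma>. \<sigma> ` mspace X \<subseteq> mspace Y \<Longrightarrow>
      \<exists>x\<in>mspace X. \<exists>x'\<in>mspace X. \<bar>mdist X x x' - mdist Y (\<sigma> x) (\<sigma> x')\<bar> \<ge> 2 * r"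
  shows "gh_dist X Y \<ge> r"
  unfolding gh_dist_def
proof (rule cInf_greatest)
  define R where "R = mspace X \<times> mspace Y"
  \<comment> \<open>To bound the infimum from below, some ambient space must exist. The full product
    is a correspondence whose distortion is at most \<open>2 * t\<close>; the 1 keeps
    \<open>t\<close> positive.\<close>
  define t where "t = 1 + (\<Sum>((x, y), (x', y'))\<in>R \<times> R. \<bar>mdist X x x' - mdist Y y y'\<bar>)"
  have t1: "t \<ge> 1" unfolding t_def by (auto intro!: sum_nonneg)
  have tR: "\<bar>mdist X x x' - mdist Y y y'\<bar> \<le> 2 * t" if "(x, y) \<in> R" "(x', y') \<in> R" for x y x' y'
  proof -
    have "(\<lambda>((x, y), (x', y')). \<bar>mdist X x x' - mdist Y y y'\<bar>) ((x, y), (x', y')) \<le>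
      (\<Sum>((x, y), (x', y'))\<in>R \<times> R. \<bar>mdist X x x' - mdist Y y y'\<bar>)"
      using that fin by (intro member_le_sum) (auto simp: R_def)
    then show ?thesis using t1 unfolding t_def by simp
  qed
  obtain Z :: "('a + 'b) metric" and A B where
    "A \<subseteq> mspace Z" "B \<subseteq> mspace Z"
    "isometric X (submetric Z A)" "isometric Y (submetric Z B)"
  proof (rule correspondence_ambient_space[of R t X Y])
    show "finite R" "R \<noteq> {}" "fst ` R = mspace X" "snd ` R = mspace Y"
      using fin ne by (auto simp: R_def)
    show "t > 0" using t1 by simp
  qed (use tR in blast)+
  then show "{hausdorff_dist Z A B | (Z :: ('a + 'b) metric) A B.
      A \<subseteq> mspace Z \<and> B \<subseteq> mspace Z \<and>
      isometric X (submetric Z A) \<and> isometric Y (submetric Z B)} \<noteq> {}"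
    by blast
next
  fix h assume "h \<in> {hausdorff_dist Z A B | (Z :: ('a + 'b) metric) A B.
      A \<subseteq> mspace Z \<and> B \<subseteq> mspace Z \<and>
      isometric X (submetric Z A) \<and> isometric Y (submetric Z B)}"
  then obtain Z :: "('a + 'b) metric" and A B where
    h: "h = hausdorff_dist Z A B" and AB: "A \<subseteq> mspace Z" "B \<subseteq> mspace Z"
    and iso: "isometric X (submetric Z A)" "isometric Y (submetric Z B)"
    by blast
  obtain f where f: "bij_betw f (mspace X) A"
    "\<And>x y. x \<in> mspace X \<Longrightarrow> y \<in> mspace X \<Longrightarrow> mdist Z (f x) (f y) = mdist X x y"
    using iso(1) AB by (auto simp: isometric_def Int_absorb2)
  obtain g where g: "bij_betw g (mspace Y) B"
    "\<And>x y. x \<in> mspace Y \<Longrightarrow> y \<in> mspace Y \<Longrightarrow> mdist Z (g x) (g y) = mdist Y x y"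
    using iso(2) AB by (auto simp: isometric_def Int_absorb2)
  have fA: "A = f ` mspace X" and gB: "B = g ` mspace Y"
    using f(1) g(1) by (auto simp: bij_betw_def)
  show "r \<le> h"
  proof (rule ccontr)
    assume "\<not> r \<le> h"
    obtain s where s: "s < r" "A \<subseteq> nbhd Z s B"
    proof (rule hausdorff_dist_lessD[of A B Z r])
      show "finite A" "finite B" "A \<noteq> {}" "B \<noteq> {}" using fin ne by (simp_all add: fA gB)
      show "hausdorff_dist Z A B < r" using \<open>\<not> r \<le> h\<close> h by simp
    qed (use AB in blast)+
    have "\<exists>y\<in>mspace Y. mdist Z (f x) (g y) < s" if "x \<in> mspace X" for x
    proof -
      have "f x \<in> nbhd Z s B" using that s fA by blast
      then show ?thesis unfolding nbhd_def gB by (auto simp: mdist_commute)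
    qed
    then obtain \<sigma> where \<sigma>: "\<And>x. x \<in> mspace X \<Longrightarrow> \<sigma> x \<in> mspace Y"
      "\<And>x. x \<in> mspace X \<Longrightarrow> mdist Z (f x) (g (\<sigma> x)) < s"
      by metis
    then obtain x x' where x: "x \<in> mspace X" "x' \<in> mspace X"
      "\<bar>mdist X x x' - mdist Y (\<sigma> x) (\<sigma> x')\<bar> \<ge> 2 * r"
      using dis[of \<sigma>] by blast
    let ?u = "f x" and ?u' = "f x'" and ?v = "g (\<sigma> x)" and ?v' = "g (\<sigma> x')"
    have m: "?u \<in> mspace Z" "?u' \<in> mspace Z" "?v \<in> mspace Z" "?v' \<in> mspace Z"
      using x \<sigma>(1) AB fA gB by blast+
    \<comment> \<open>Going around the quadrilateral both ways, the two distances differ by less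
      than \<open>2 * s\<close>, hence by less than \<open>2 * r\<close>.\<close>
    have "mdist Z ?u ?u' \<le> mdist Z ?u ?v + mdist Z ?v ?u'" "mdist Z ?v ?u' \<le> mdist Z ?v ?v' + mdist Z ?v' ?u'"
      "mdist Z ?v ?v' \<le> mdist Z ?v ?u + mdist Z ?u ?v'" "mdist Z ?u ?v' \<le> mdist Z ?u ?u' + mdist Z ?u' ?v'"
      using m by (auto intro: mdist_triangle)
    then show False
      using x(3) f(2)[OF x(1,2)] g(2)[OF \<sigma>(1)[OF x(1)] \<sigma>(1)[OF x(2)]] \<sigma>(2)[OF x(1)] \<sigma>(2)[OF x(2)] s(1)
      by (auto simp: mdist_commute)
  qed
qed

section \<open>Metrics given by edge lengths\<close>

definition edges :: "'a set \<Rightarrow> 'a set set" where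
  "edges S = {e. e \<subseteq> S \<and> card e = 2}"

lemma pair_in_edges [simp]: "{i, j} \<in> edges S \<longleftrightarrow> i \<in> S \<and> j \<in> S \<and> i \<noteq> j"
  by (auto simp: edges_def card_insert_if)

lemma edgesE:
  assumes "e \<in> edges S" obtains i j where "e = {i, j}" "i \<in> S" "j \<in> S" "i \<noteq> j"
  using assms by (auto simp: edges_def card_2_iff)

text \<open>Lengths are attached to unordered pairs, so symmetry is built in.\<close>

definition edge_metric :: "'a set \<Rightarrow> ('a set \<Rightarrow> real) \<Rightarrow> 'a metric" where
  "edge_metric S w = metric (S, \<lambda>i j. if i = j then 0 else w {i, j})"

text \<open>With lengths between \<open>m\<close> and \<open>2 * m\<close>, two sides of a triangle
  always add up to at least the third. The lower bound ranges over all sets because a metric must be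
  nonnegative outside \<open>S\<close> as well.\<close>

lemma edge_metric:
  assumes m: "m > 0" and lower: "\<And>e. m \<le> w e" and upper: "\<And>e. e \<in> edges S \<Longrightarrow> w e \<le> 2 * m"
  shows "mspace (edge_metric S w) = S"
    and "mdist (edge_metric S w) = (\<lambda>i j. if i = j then 0 else w {i, j})"
proof -
  let ?d = "\<lambda>i j. if i = j then 0 else w {i, j}"
  interpret Metric_space S ?d
  proof
    show "0 \<le> ?d i j" for i j using m lower[of "{i, j}"] by simp
    show "?d i j = ?d j i" for i j by (simp add: insert_commute)
    show "?d i j = 0 \<longleftrightarrow> i = j" for i j using m lower[of "{i, j}"] by simp
    show "?d i l \<le> ?d i j + ?d j l" if "i \<in> S" "j \<in> S" "l \<in> S" for i j l
      using m lower[of "{i, j}"] lower[of "{j, l}"] upper[of "{i, l}"] that by auto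
  qed
  show "mspace (edge_metric S w) = S" "mdist (edge_metric S w) = ?d"
    by (simp_all add: edge_metric_def)
qed

text \<open>The bound \<open>4 D\<close> on the differences of \<open>C\<close> confines any competing correspondence to the edges.\<close>

lemma gh_dist_edge_metric:
  fixes X :: "'a metric" and S :: "'b set" and C :: "'b set \<Rightarrow> real"
  assumes S: "finite S" "S \<noteq> {}"
    and D: "D > 0" "\<And>x y. x \<in> mspace X \<Longrightarrow> y \<in> mspace X \<Longrightarrow> mdist X x y \<le> D"
    and p: "p ` edges S = mspace X"
    and m: "m \<ge> 4 * D" "\<And>e. m \<le> C e" "\<And>e. e \<in> edges S \<Longrightarrow> C e + 2 * D \<le> 2 * m"
    and gap: "\<And>e e'. e \<in> edges S \<Longrightarrow> e' \<in> edges S \<Longrightarrow> e \<noteq> e' \<Longrightarrow> \<bar>C e - C e'\<bar> \<ge> 4 * D"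
    and xy: "x \<in> mspace X" "y \<in> mspace X"
  shows "gh_dist (edge_metric S (\<lambda>e. C e + 2 * mdist X x (p e)))
           (edge_metric S (\<lambda>e. C e + 2 * mdist X y (p e))) = mdist X x y"
proof -
  define w where "w z e = C e + 2 * mdist X z (p e)" for z e
  have pX: "p e \<in> mspace X" if "e \<in> edges S" for e using that p by blast
  have m0: "m > 0" using m(1) D(1) by simp
  have w_ge: "m \<le> w z e" for z e using m(2)[of e] by (simp add: w_def add_increasing2)
  have w_le: "w z e \<le> 2 * m" if "z \<in> mspace X" "e \<in> edges S" for z e
    using m(3)[OF that(2)] D(2)[OF that(1) pX[OF that(2)]] by (simp add: w_def)
  have M: "mspace (edge_metric S (w z)) = S"
    "mdist (edge_metric S (w z)) = (\<lambda>i j. if i = j then 0 else w z {i, j})" if "z \<in> mspace X" for z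
    using edge_metric[where w = "w z", OF m0 w_ge w_le[OF that]] by blast+
  have "gh_dist (edge_metric S (w x)) (edge_metric S (w y)) \<le> mdist X x y"
  \<comment> \<open>\<open>gh_dist_le_distortion\<close> wants a positive bound, while
    \<open>x = y\<close> is allowed; hence the slack.\<close>
  proof (rule field_le_epsilon)
    fix \<epsilon> :: real assume "\<epsilon> > 0"
    show "gh_dist (edge_metric S (w x)) (edge_metric S (w y)) \<le> mdist X x y + \<epsilon>"
    \<comment> \<open>The identity keeps every edge, so the constants \<open>C\<close> cancel and
      the triangle inequality in \<open>X\<close> bounds the rest.\<close>
    proof (rule gh_dist_le_distortion[of "Id_on S"])
      fix i j i' j' assume "(i, j) \<in> Id_on S" "(i', j') \<in> Id_on S"
      then have ij: "j = i" "j' = i'" "i \<in> S" "i' \<in> S" by auto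
      show "\<bar>mdist (edge_metric S (w x)) i i' - mdist (edge_metric S (w y)) j j'\<bar> \<le> 2 * (mdist X x y + \<epsilon>)"
      proof (cases "i = i'")
        case True
        then show ?thesis using ij xy M \<open>\<epsilon> > 0\<close> by simp
      next
        case False
        then have q: "p {i, i'} \<in> mspace X" using pX ij by simp
        have "\<bar>mdist X x (p {i, i'}) - mdist X y (p {i, i'})\<bar> \<le> mdist X x y"
          using mdist_triangle[OF xy q] mdist_triangle[OF xy(2,1) q]
          by (simp add: mdist_commute[of X y x])
        then show ?thesis using False ij xy M \<open>\<epsilon> > 0\<close> by (simp add: w_def)
      qed
    qed (use S M xy \<open>\<epsilon> > 0\<close> in \<open>auto simp: Id_on_def add_nonneg_pos image_UN\<close>)
  qed
  moreover have "mdist X x y \<le> gh_dist (edge_metric S (w x)) (edge_metric S (w y))"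
  proof (rule gh_dist_ge_distortion)
    fix \<sigma> assume "\<sigma> ` mspace (edge_metric S (w x)) \<subseteq> mspace (edge_metric S (w y))"
    then have \<sigma>: "\<sigma> i \<in> S" if "i \<in> S" for i using that M xy by blast
    define \<delta> where "\<delta> i j = \<bar>mdist (edge_metric S (w x)) i j - mdist (edge_metric S (w y)) (\<sigma> i) (\<sigma> j)\<bar>" for i j
    \<comment> \<open>At the edge labelled \<open>y\<close>, the Kuratowski images of
      \<open>x\<close> and \<open>y\<close> differ by exactly \<open>mdist X x y\<close>.\<close>
    obtain e where e: "e \<in> edges S" "p e = y" using p xy by (metis imageE)
    obtain i j where ij: "e = {i, j}" "i \<in> S" "j \<in> S" "i \<noteq> j" using e(1) by (rule edgesE)
    have "2 * mdist X x y \<le> \<delta> i j"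
    proof (rule ccontr)
      assume "\<not> 2 * mdist X x y \<le> \<delta> i j"
      then have less: "\<delta> i j < 2 * mdist X x y" by simp
      have xyD: "mdist X x y \<le> D" using D(2) xy by simp
      \<comment> \<open>Collapsing the edge would cost its whole length, at least
        \<open>4 * D\<close>.\<close>
      have ne: "\<sigma> i \<noteq> \<sigma> j"
      proof
        assume "\<sigma> i = \<sigma> j"
        then have "\<delta> i j = \<bar>w x e\<bar>" using M xy ij by (simp add: \<delta>_def)
        then show False using less xyD w_ge[of x e] m(1) D(1) by simp
      qed
      define e' where "e' = {\<sigma> i, \<sigma> j}"
      have e': "e' \<in> edges S" using \<sigma> ij ne by (simp add: e'_def)
      have \<delta>: "\<delta> i j = \<bar>w x e - w y e'\<bar>" using M xy ij ne by (simp add: \<delta>_def e'_def)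
      show False
      proof (cases "e' = e")
        case True
        moreover have "mdist X y (p e) = 0" using e(2) xy by simp
        ultimately show False using less \<delta> e(2) by (simp add: w_def)
      next
        case False
        \<comment> \<open>The variable parts of the lengths lie between 0 and \<open>2 * D\<close>,
          so a gap of \<open>4 * D\<close> in the constants leaves at least
          \<open>2 * D\<close>.\<close>
        have "mdist X x (p e) \<le> D" "mdist X y (p e') \<le> D" using D(2) xy pX e e' by auto
        moreover have "mdist X x (p e) \<ge> 0" "mdist X y (p e') \<ge> 0" by simp_all
        moreover have "\<bar>C e - C e'\<bar> \<ge> 4 * D" using gap[OF e(1) e'] False by blast
        ultimately show False using less \<delta> xyD unfolding w_def by linarith
      qed
    qed
    then show "\<exists>i\<in>mspace (edge_metric S (w x)). \<exists>j\<in>mspace (edge_metric S (w x)).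
       2 * mdist X x y \<le> \<bar>mdist (edge_metric S (w x)) i j - mdist (edge_metric S (w y)) (\<sigma> i) (\<sigma> j)\<bar>"
      unfolding M(1)[OF xy(1)] \<delta>_def using ij by blast
  qed (use S M xy in auto)
  ultimately show ?thesis by (simp add: w_def[abs_def])
qed

section \<open>Isometry classes of finite metric spaces\<close>

lemma compact_space_finite: "finite (mspace X) \<Longrightarrow> compact_space (mtopology_of X)"
  by (simp add: compact_space_def finite_imp_compactin)

text \<open>The quotient is partial, so its equations require representatives that are related to
  themselves.\<close>

lemma compact_isometric_finite:
  "finite (mspace X) \<Longrightarrow> mspace X \<noteq> {} \<Longrightarrow> compact_isometric X X"
  by (simp add: compact_isometric_def compact_space_finite isometric_refl)

lemma d_GH_abs_gh_space:
  assumes "finite (mspace X)" "mspace X \<noteq> {}" "finite (mspace Y)" "mspace Y \<noteq> {}"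
  shows "d_GH (abs_gh_space X) (abs_gh_space Y) = gh_dist X Y"
  using assms by (simp add: d_GH.abs_eq compact_isometric_finite)

lemma abs_gh_space_in_gh_points:
  assumes "finite (mspace X)" "mspace X \<noteq> {}" "card (mspace X) = k"
  shows "abs_gh_space X \<in> gh_points k"
  using assms by (simp add: gh_points_def has_points.abs_eq compact_isometric_finite)

section \<open>Choice of labels and constants, and the embedding\<close>

theorem theorem5p1:
  fixes X :: "'a metric" and n k :: nat
  assumes "finite (mspace X)" and "card (mspace X) = n" and "n \<ge> 1"
    and "k = (LEAST j. j > 0 \<and> n \<le> j * (j - 1) div 2)"
  shows "\<exists>\<phi> :: 'a \<Rightarrow> gh_space.
           \<phi> ` mspace X \<subseteq> gh_points k \<and>
           (\<forall>x\<in>mspace X. \<forall>y\<in>mspace X. d_GH (\<phi> x) (\<phi> y) = mdist X x y)"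
proof -
  \<comment> \<open>The number \<open>n + 1\<close> satisfies the condition, so the least
    \<open>k\<close> is attained.\<close>
  have "n * 2 \<le> (n + 1) * n"
    using assms(3) by (cases n) (auto simp: algebra_simps)
  then have "Suc n > 0 \<and> n \<le> Suc n * (Suc n - 1) div 2"
    using div_le_mono[of "n * 2" "(n + 1) * n" 2] by simp
  then have k: "k > 0" "n \<le> k * (k - 1) div 2"
    unfolding assms(4) using LeastI[of "\<lambda>j. j > 0 \<and> n \<le> j * (j - 1) div 2"] by blast+
  \<comment> \<open>Representatives of isometry classes live on \<open>real\<close>; only the
    cardinality of \<open>S\<close> matters.\<close>
  define S where "S = real ` {..<k}"
  have S: "finite S" "card S = k" by (simp_all add: S_def card_image)
  then have S0: "S \<noteq> {}" using k by auto
  have finE: "finite (edges S)" using S by (simp add: edges_def)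
  have "card (edges S) = k * (k - 1) div 2"
    unfolding edges_def using n_subsets[OF S(1), of 2] S(2) by (simp add: choose_two)
  then have "card (mspace X) \<le> card (edges S)" using k assms(2) by simp
  then obtain f where f: "f ` mspace X \<subseteq> edges S" "inj_on f (mspace X)"
    using card_le_inj[OF assms(1) finE] by blast
  obtain x0 where x0: "x0 \<in> mspace X" using assms(2,3) by fastforce
  \<comment> \<open>A left inverse of \<open>f\<close>; the edges outside its image receive the
    arbitrary label \<open>x0\<close>.\<close>
  define p where "p e = (if e \<in> f ` mspace X then inv_into (mspace X) f e else x0)" for e
  have "p (f x) = x" if "x \<in> mspace X" for x using f that by (simp add: p_def)
  moreover have "p e \<in> mspace X" for e using x0 by (auto simp: p_def inv_into_into)
  ultimately have p: "p ` edges S = mspace X" using f(1) by (force simp: image_iff)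
  \<comment> \<open>The 1 keeps the diameter bound positive when \<open>X\<close> is a single
    point.\<close>
  define D where "D = 1 + (\<Sum>(x, y)\<in>mspace X \<times> mspace X. mdist X x y)"
  have D1: "D \<ge> 1" unfolding D_def by (auto intro!: sum_nonneg)
  have D: "mdist X x y \<le> D" if "x \<in> mspace X" "y \<in> mspace X" for x y
  proof -
    have "(\<lambda>(x, y). mdist X x y) (x, y) \<le> (\<Sum>(x, y)\<in>mspace X \<times> mspace X. mdist X x y)"
      using that assms(1) by (intro member_le_sum) auto
    then show ?thesis by (simp add: D_def)
  qed
  obtain c where "bij_betw c (edges S) {0..<card (edges S)}"
    using ex_bij_betw_finite_nat[OF finE] by blast
  then have c: "inj_on c (edges S)" "\<And>e. e \<in> edges S \<Longrightarrow> c e < card (edges S)"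
    by (auto simp: bij_betw_def)
  \<comment> \<open>Numbering the edges by \<open>c\<close> spaces the constants
    \<open>4 * D\<close> apart, starting at \<open>m\<close>. The factor
    \<open>card (edges S) + 1\<close> makes \<open>m\<close> large enough that even the longest
    edge, with its extra \<open>2 * D\<close>, stays below \<open>2 * m\<close>.\<close>
  define m where "m = 4 * D * (card (edges S) + 1)"
  define C where "C e = m + 4 * D * c e" for e
  have m4: "m \<ge> 4 * D" using D1 by (simp add: m_def)
  have C_ge: "m \<le> C e" for e using D1 by (simp add: C_def)
  have C_le: "C e + 2 * D \<le> 2 * m" if "e \<in> edges S" for e
  proof -
    have "4 * D * c e \<le> 4 * D * card (edges S)"
      using c(2)[OF that] D1 by (intro mult_left_mono) auto
    moreover have "m = 4 * D * card (edges S) + 4 * D" by (simp add: m_def algebra_simps)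
    ultimately show ?thesis using D1 unfolding C_def by linarith
  qed
  have gap: "\<bar>C e - C e'\<bar> \<ge> 4 * D" if "e \<in> edges S" "e' \<in> edges S" "e \<noteq> e'" for e e'
  proof -
    have "c e \<noteq> c e'" using c(1) that by (auto dest: inj_onD)
    then have "1 \<le> \<bar>real (c e) - real (c e')\<bar>" by linarith
    then have "4 * D * 1 \<le> 4 * D * \<bar>real (c e) - real (c e')\<bar>"
      using D1 by (intro mult_left_mono) auto
    also have "\<dots> = \<bar>4 * D * (real (c e) - real (c e'))\<bar>" using D1 by (simp add: abs_mult)
    also have "\<dots> = \<bar>C e - C e'\<bar>" by (simp add: C_def algebra_simps)
    finally show ?thesis by simp
  qed
  define K where "K x = edge_metric S (\<lambda>e. C e + 2 * mdist X x (p e))" for x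
  have K: "mspace (K x) = S" if "x \<in> mspace X" for x
    unfolding K_def
  proof (rule edge_metric(1))
    show "m > 0" using m4 D1 by simp
    show "m \<le> C e + 2 * mdist X x (p e)" for e using C_ge[of e] by (simp add: add_increasing2)
    show "C e + 2 * mdist X x (p e) \<le> 2 * m" if "e \<in> edges S" for e
      using C_le[OF that] D[OF \<open>x \<in> mspace X\<close>, of "p e"] p that by force
  qed
  have "gh_dist (K x) (K y) = mdist X x y" if "x \<in> mspace X" "y \<in> mspace X" for x y
    unfolding K_def
    using D1 by (intro gh_dist_edge_metric[OF S(1) S0 _ D p m4 C_ge C_le gap that]) auto
  then show ?thesis
    using K S S0
    by (intro exI[of _ "\<lambda>x. abs_gh_space (K x)"])
       (auto simp: d_GH_abs_gh_space intro: abs_gh_space_in_gh_points)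
qed

end
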